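(* Let $m\ge 4$ be an integer and let $QD_{2^m}=\langle a,b : a^{2^{m-1}}=b^2=1,\ bab^{-1}=a^{2^{m-2}-1}\rangle$ be the quasidihedral group. Then \[ \mathrm{CSCom}(QD_{2^m})\cong K_2\vee\left(2K_{2^{m-2}}\sqcup K_{2^{m-1}-2}\right). \]
   Context: For a finite group $G$, the conjugacy super commuting graph $\mathrm{CSCom}(G)$ is the simple graph with vertex set $G$ in which two distinct vertices $g,h$ are adjacent if and only if either $g$ and $h$ are conjugate in $G$, or there exist $g'$ in the conjugacy class of $g$ and $h'$ in the conjugacy class of $h$ with $g'h'=h'g'$. $K_r$ is the complete graph on $r$ vertices, $\sqcup$ is disjoint union of graphs, $sK_r$ is the disjoint union of $s$ copies of $K_r$, and $\vee$ is the join of graphs (disjoint union together with all edges between the two vertex sets). *)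

theory Defs
  imports
    "HOL-Algebra.Group_Action"
    "Graph_Theory.Pair_Digraph"
    "Graph_Theory.Digraph_Isomorphism"
    "Graph_Theory.Kuratowski"
begin

datatype 'x letter = Gen 'x | Inv 'x

fun flip_letter :: "'x letter \<Rightarrow> 'x letter" where
  "flip_letter (Gen x) = Inv x"
| "flip_letter (Inv x) = Gen x"

text \<open>The set \<open>R\<close> consists of the defining relations, a pair \<open>(u, v)\<close> standing for the
  equation \<open>u = v\<close>. All elements of the type \<open>'x\<close> are generators.\<close>

inductive pres_eq :: "('x letter list \<times> 'x letter list) set \<Rightarrow>
    'x letter list \<Rightarrow> 'x letter list \<Rightarrow> bool" for R where
  rel: "(u, v) \<in> R \<Longrightarrow> pres_eq R u v"
| cancel: "pres_eq R [l, flip_letter l] []"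
| refl: "pres_eq R u u"
| sym: "pres_eq R u v \<Longrightarrow> pres_eq R v u"
| trans: "pres_eq R u v \<Longrightarrow> pres_eq R v w \<Longrightarrow> pres_eq R u w"
| append: "pres_eq R u u' \<Longrightarrow> pres_eq R v v' \<Longrightarrow> pres_eq R (u @ v) (u' @ v')"

definition pres_rel :: "('x letter list \<times> 'x letter list) set \<Rightarrow> 'x letter list rel" where
  "pres_rel R = {(u, v). pres_eq R u v}"

definition presented_group :: "('x letter list \<times> 'x letter list) set \<Rightarrow> 'x letter list set monoid"
  where
  "presented_group R =
    \<lparr> carrier = UNIV // pres_rel R,
      monoid.mult = (\<lambda>A B. \<Union>u\<in>A. \<Union>v\<in>B. pres_rel R `` {u @ v}),
      one = pres_rel R `` {[]} \<rparr>"

lemma equiv_pres_rel: "equiv UNIV (pres_rel R)"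
  by (rule equivI)
    (auto simp: pres_rel_def refl_on_def
      intro!: symI transI intro: pres_eq.refl pres_eq.sym pres_eq.trans)

lemma mult_presented_group:
  "(pres_rel R `` {u}) \<otimes>\<^bsub>presented_group R\<^esub> (pres_rel R `` {v}) = pres_rel R `` {u @ v}"
proof -
  have "congruent2 (pres_rel R) (pres_rel R) (\<lambda>u v. pres_rel R `` {u @ v})"
  proof (rule congruent2I')
    fix u u' v v' assume "(u, u') \<in> pres_rel R" "(v, v') \<in> pres_rel R"
    then have "(u @ v, u' @ v') \<in> pres_rel R"
      by (auto simp: pres_rel_def intro: pres_eq.append)
    then show "pres_rel R `` {u @ v} = pres_rel R `` {u' @ v'}"
      by (rule equiv_class_eq[OF equiv_pres_rel])
  qed
  then show ?thesis
    unfolding presented_group_def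
    using UN_equiv_class2[OF equiv_pres_rel equiv_pres_rel] by fastforce
qed

lemma flip_word_left: "pres_eq R (rev (map flip_letter w) @ w) []"
proof (induction w)
  case Nil
  then show ?case by (simp add: pres_eq.refl)
next
  case (Cons l w)
  have "flip_letter (flip_letter l) = l" by (cases l) auto
  then have "pres_eq R [flip_letter l, l] []"
    using pres_eq.cancel[of R "flip_letter l"] by simp
  then have "pres_eq R (rev (map flip_letter w) @ ([flip_letter l, l] @ w))
      (rev (map flip_letter w) @ ([] @ w))"
    by (intro pres_eq.append pres_eq.refl)
  then have "pres_eq R (rev (map flip_letter (l # w)) @ l # w) (rev (map flip_letter w) @ w)"
    by simp
  then show ?case using Cons.IH pres_eq.trans by blast
qed

lemma group_presented_group: "group (presented_group R)"
proof (rule groupI)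
  have carr: "carrier (presented_group R) = range (\<lambda>u. pres_rel R `` {u})"
    by (auto simp: presented_group_def quotient_def)
  have one: "\<one>\<^bsub>presented_group R\<^esub> = pres_rel R `` {[]}"
    by (simp add: presented_group_def)
  show "\<one>\<^bsub>presented_group R\<^esub> \<in> carrier (presented_group R)"
    using carr one by auto
  fix x assume "x \<in> carrier (presented_group R)"
  then obtain u where u: "x = pres_rel R `` {u}" using carr by auto
  show "\<one>\<^bsub>presented_group R\<^esub> \<otimes>\<^bsub>presented_group R\<^esub> x = x"
    by (simp add: u one mult_presented_group)
  have "pres_rel R `` {rev (map flip_letter u) @ u} = pres_rel R `` {[]}"
    by (rule equiv_class_eq[OF equiv_pres_rel]) (simp add: pres_rel_def flip_word_left)
  then show "\<exists>y\<in>carrier (presented_group R). y \<otimes>\<^bsub>presented_group R\<^esub> x = \<one>\<^bsub>presented_group R\<^esub>"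
    by (auto simp: u one carr mult_presented_group)
  fix y assume "y \<in> carrier (presented_group R)"
  then obtain v where v: "y = pres_rel R `` {v}" using carr by auto
  show "x \<otimes>\<^bsub>presented_group R\<^esub> y \<in> carrier (presented_group R)"
    by (simp add: u v carr mult_presented_group)
  fix z assume "z \<in> carrier (presented_group R)"
  then obtain w where w: "z = pres_rel R `` {w}" using carr by auto
  show "x \<otimes>\<^bsub>presented_group R\<^esub> y \<otimes>\<^bsub>presented_group R\<^esub> z =
      x \<otimes>\<^bsub>presented_group R\<^esub> (y \<otimes>\<^bsub>presented_group R\<^esub> z)"
    by (simp add: u v w mult_presented_group)
qed

datatype qd_gen = QD_a | QD_b

definition quasidihedral_group :: "nat \<Rightarrow> qd_gen letter list set monoid" where
  "quasidihedral_group m = presented_group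
    { (replicate (2 ^ (m - 1)) (Gen QD_a), []),
      ([Gen QD_b, Gen QD_b], []),
      ([Gen QD_b, Gen QD_a, Inv QD_b], replicate (2 ^ (m - 2) - 1) (Gen QD_a)) }"

text \<open>A finite simple graph is a \<^locale>\<open>pair_graph\<close>, each edge being represented by
  its two opposite arcs.\<close>

definition complete_pair_graph :: "nat \<Rightarrow> nat pair_pre_digraph" where
  "complete_pair_graph r =
    \<lparr> pverts = {..<r}, parcs = {(u, v). u < r \<and> v < r \<and> u \<noteq> v} \<rparr>"

definition disjoint_union_graph ::
  "'u pair_pre_digraph \<Rightarrow> 'v pair_pre_digraph \<Rightarrow> ('u + 'v) pair_pre_digraph" where
  "disjoint_union_graph G H =
    \<lparr> pverts = pverts G <+> pverts H,
      parcs = {(Inl u, Inl u') | u u'. (u, u') \<in> parcs G} \<union>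
              {(Inr v, Inr v') | v v'. (v, v') \<in> parcs H} \<rparr>"

definition copies_graph :: "nat \<Rightarrow> 'v pair_pre_digraph \<Rightarrow> (nat \<times> 'v) pair_pre_digraph" where
  "copies_graph s G =
    \<lparr> pverts = {..<s} \<times> pverts G,
      parcs = {((i, u), (i, v)) | i u v. i < s \<and> (u, v) \<in> parcs G} \<rparr>"

definition join_graph ::
  "'u pair_pre_digraph \<Rightarrow> 'v pair_pre_digraph \<Rightarrow> ('u + 'v) pair_pre_digraph" where
  "join_graph G H =
    \<lparr> pverts = pverts (disjoint_union_graph G H),
      parcs = parcs (disjoint_union_graph G H) \<union>
              {(Inl u, Inr v) | u v. u \<in> pverts G \<and> v \<in> pverts H} \<union>
              {(Inr v, Inl u) | u v. u \<in> pverts G \<and> v \<in> pverts H} \<rparr>"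

lemma complete_pair_graph: "K\<^bsub>r\<^esub> (with_proj (complete_pair_graph r))"
  by (auto simp: complete_digraph_pair_def complete_pair_graph_def)

definition conj_class :: "('a, 'b) monoid_scheme \<Rightarrow> 'a \<Rightarrow> 'a set" where
  "conj_class G x = Group_Action.orbit G (\<lambda>g. \<lambda>h \<in> carrier G. g \<otimes>\<^bsub>G\<^esub> h \<otimes>\<^bsub>G\<^esub> inv\<^bsub>G\<^esub> g) x"

definition CSCom :: "('a, 'b) monoid_scheme \<Rightarrow> 'a pair_pre_digraph" where
  "CSCom G =
    \<lparr> pverts = carrier G,
      parcs = {(g, h). g \<in> carrier G \<and> h \<in> carrier G \<and> g \<noteq> h \<and>
        (h \<in> conj_class G g \<or>
         (\<exists>g' \<in> conj_class G g. \<exists>h' \<in> conj_class G h. g' \<otimes>\<^bsub>G\<^esub> h' = h' \<otimes>\<^bsub>G\<^esub> g'))} \<rparr>"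

lemma pair_graph_CSCom:
  assumes "group G" and "finite (carrier G)"
  shows "pair_graph (CSCom G)"
proof -
  interpret A: group_action G "carrier G" "\<lambda>g. \<lambda>h \<in> carrier G. g \<otimes>\<^bsub>G\<^esub> h \<otimes>\<^bsub>G\<^esub> inv\<^bsub>G\<^esub> g"
    by (rule group.action_by_conjugation[OF assms(1)])
  have conj_sym: "g \<in> conj_class G h"
    if "h \<in> conj_class G g" "g \<in> carrier G" "h \<in> carrier G" for g h
    using A.orbit_sym that unfolding conj_class_def by blast
  have fin: "finite (parcs (CSCom G))"
    by (rule finite_subset[of _ "carrier G \<times> carrier G"]) (auto simp: CSCom_def assms(2))
  have "sym (parcs (CSCom G))"
    by (rule symI) (auto simp: CSCom_def intro: conj_sym, metis)
  then show ?thesis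
    using fin by unfold_locales (auto simp: CSCom_def symmetric_def assms(2))
qed

end

theory Submission
  imports Defs
begin

text \<open>Write \<open>n = 2\<^sup>m\<^sup>-\<^sup>1 = 4q\<close>, so that \<open>b\<close> conjugates \<open>a\<close> to the power \<open>2q - 1\<close>, with \<open>q\<close> even. Every
  element of the group is \<open>a\<^sup>i b\<^sup>e\<close> with \<open>i\<close> unique modulo \<open>4q\<close> and \<open>e\<close> a bit. The whole argument
  rests on one computation: \<open>b\<close> commutes with \<open>a\<^sup>x\<close> iff \<open>4q\<close> divides \<open>(2q - 2)x\<close>, and because \<open>q - 1\<close>
  is prime to \<open>2q\<close> this means \<open>2q dvd x\<close> (\<open>dvd_cancel_twist\<close>).

  Consequently the centre is \<open>{1, a\<^sup>2\<^sup>q}\<close>, a reflection \<open>a\<^sup>i b\<close> commutes with a noncentral rotation never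
  and with another reflection \<open>a\<^sup>j b\<close> only when \<open>i\<close> and \<open>j\<close> agree modulo \<open>2q\<close>, in particular only
  when they have the same parity. Conversely, conjugation by \<open>a\<^sup>x\<close> shifts the exponent of a reflection by
  \<open>- (2q - 2)x\<close>, which reaches every exponent of the same parity. The group therefore splits into
  four blocks that conjugation respects: the centre (2 elements), the noncentral rotations
  (\<open>4q - 2\<close> elements) and the reflections of either parity (\<open>2q\<close> elements each). Distinct vertices of
  the graph are adjacent iff one of them is central or both lie in the same block
  (\<open>parcs_CSCom\<close>). The target graph is described by the same rule with blocks of the same sizes, and
  any block-preserving bijection is then an isomorphism (\<open>digraph_iso_by_colours\<close>).

  The remaining difficulty is that the presentation might collapse: uniqueness of \<open>i\<close> and \<open>e\<close> has to
  be shown. Words act on the pairs \<open>(i, e)\<close> the way left multiplication should act on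
  \<open>a\<^sup>i b\<^sup>e\<close>, and the defining relations act trivially modulo \<open>4q\<close> (\<open>pres_eq_same_action\<close>), so words that
  represent the same element send \<open>(0, False)\<close> to the same pair modulo \<open>4q\<close>.\<close>

section \<open>Graphs whose adjacency is a function of a colouring\<close>

lemma bij_betw_preserving_colours:
  assumes "finite A" "finite B"
    and "\<And>k. card {x \<in> A. c x = k} = card {y \<in> B. d y = k}"
  obtains f where "bij_betw f A B" "\<And>x. x \<in> A \<Longrightarrow> d (f x) = c x"
proof -
  have "\<exists>h. bij_betw h {x \<in> A. c x = k} {y \<in> B. d y = k}" for k
    using assms by (intro finite_same_card_bij) auto
  then obtain h where h: "bij_betw (h k) {x \<in> A. c x = k} {y \<in> B. d y = k}" for k
    by metis
  define f where "f x = h (c x) x" for x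
  have f: "f x \<in> B \<and> d (f x) = c x" if "x \<in> A" for x
    using bij_betwE[OF h[of "c x"]] that by (auto simp: f_def)
  moreover have "inj_on f A"
  proof (rule inj_onI)
    fix x y assume xy: "x \<in> A" "y \<in> A" "f x = f y"
    then have "c x = c y" using f by metis
    then show "x = y"
      using xy bij_betw_imp_inj_on[OF h[of "c x"]] by (auto simp: f_def inj_on_def)
  qed
  moreover have "B \<subseteq> f ` A"
  proof
    fix y assume "y \<in> B"
    then have "y \<in> h (d y) ` {x \<in> A. c x = d y}"
      using bij_betw_imp_surj_on[OF h[of "d y"]] by auto
    then obtain x where "x \<in> A" "c x = d y" "y = h (d y) x" by blast
    then have "y = f x" by (simp add: f_def)
    then show "y \<in> f ` A" using \<open>x \<in> A\<close> by blast
  qed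
  ultimately show thesis
    using that[of f] by (auto simp: bij_betw_def)
qed

text \<open>If adjacency of distinct vertices depends only on their colours, vertices of one colour are
  interchangeable, so the sizes of the colour classes determine the graph up to isomorphism.\<close>

lemma digraph_iso_by_colours:
  fixes G :: "'u pair_pre_digraph" and H :: "'v pair_pre_digraph"
  assumes fin: "finite (pverts G)" "finite (pverts H)"
    and G: "parcs G = {(u, v). u \<in> pverts G \<and> v \<in> pverts G \<and> u \<noteq> v \<and> adj (c u) (c v)}"
    and H: "parcs H = {(u, v). u \<in> pverts H \<and> v \<in> pverts H \<and> u \<noteq> v \<and> adj (d u) (d v)}"
    and sizes: "\<And>k. card {u \<in> pverts G. c u = k} = card {v \<in> pverts H. d v = k}"
  shows "digraph_iso (with_proj G) (with_proj H)"
proof -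
  obtain f where f: "bij_betw f (pverts G) (pverts H)"
    and df: "\<And>u. u \<in> pverts G \<Longrightarrow> d (f u) = c u"
    using bij_betw_preserving_colours[OF fin sizes] by blast
  have inj: "inj_on f (pverts G)" and surj: "f ` pverts G = pverts H"
    using f by (auto simp: bij_betw_def)
  let ?hom = "\<lparr> iso_verts = f, iso_arcs = map_prod f f, iso_head = snd, iso_tail = fst \<rparr>"
  have "wf_digraph (with_proj G)"
    by unfold_locales (auto simp: G)
  moreover have "inj_on (map_prod f f) (parcs G)"
    using inj by (auto simp: G inj_on_def)
  ultimately have "pre_digraph.digraph_isomorphism (with_proj G) ?hom"
    using inj by (auto simp: pre_digraph.digraph_isomorphism_def)
  moreover have "map_prod f f ` parcs G = parcs H"
  proof
    show "map_prod f f ` parcs G \<subseteq> parcs H"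
      using surj df inj by (auto simp: G H inj_on_def)
    show "parcs H \<subseteq> map_prod f f ` parcs G"
    proof
      fix p assume "p \<in> parcs H"
      then obtain x y where xy: "p = (x, y)" "x \<in> f ` pverts G" "y \<in> f ` pverts G"
        and adj: "x \<noteq> y" "adj (d x) (d y)"
        using surj by (auto simp: H)
      then obtain u v where uv: "p = (f u, f v)" "u \<in> pverts G" "v \<in> pverts G"
        and "f u \<noteq> f v" "adj (d (f u)) (d (f v))"
        by blast
      then have "(u, v) \<in> parcs G" by (auto simp: G df)
      then show "p \<in> map_prod f f ` parcs G" using uv by force
    qed
  qed
  then have "with_proj H = app_iso ?hom (with_proj G)"
    using surj by (simp add: app_iso_def with_proj_def)
  ultimately show ?thesis unfolding digraph_iso_def by blast
qed

section \<open>Conjugacy and commutation in coordinates\<close>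

text \<open>Writing the conjugacy \<open>h = x g x\<inverse>\<close> as \<open>h x = x g\<close> reduces it to the multiplication rule, with no
  formula for inverses in coordinates.\<close>

lemma (in group) conj_class_iff:
  assumes "g \<in> carrier G"
  shows "h \<in> conj_class G g \<longleftrightarrow> h \<in> carrier G \<and> (\<exists>x \<in> carrier G. h \<otimes> x = x \<otimes> g)"
proof
  assume "h \<in> conj_class G g"
  then obtain x where "x \<in> carrier G" "h = x \<otimes> g \<otimes> inv x"
    using assms by (auto simp: conj_class_def Group_Action.orbit_def)
  then show "h \<in> carrier G \<and> (\<exists>x \<in> carrier G. h \<otimes> x = x \<otimes> g)"
    using assms by (auto simp: m_assoc intro!: bexI[of _ x])
next
  assume "h \<in> carrier G \<and> (\<exists>x \<in> carrier G. h \<otimes> x = x \<otimes> g)"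
  then obtain x where x: "h \<in> carrier G" "x \<in> carrier G" "h \<otimes> x = x \<otimes> g" by blast
  then have "h = x \<otimes> g \<otimes> inv x"
    using assms by (metis inv_solve_right m_closed)
  then show "h \<in> conj_class G g"
    using assms x by (auto simp: conj_class_def Group_Action.orbit_def)
qed

text \<open>The flag of a reflection \<open>a\<^sup>i b\<close> is \<open>True\<close> for even \<open>i\<close>. The central elements are kept apart from
  the other rotations because they are adjacent to everything.\<close>

datatype block = Centre | Rotation | Reflection bool

definition block_adj :: "block \<Rightarrow> block \<Rightarrow> bool" where
  "block_adj x y \<longleftrightarrow> x = Centre \<or> y = Centre \<or> x = y"

text \<open>Here \<open>elt i e\<close> stands for \<open>a\<^sup>i b\<^sup>e\<close>, where \<open>a\<close> has order \<open>4q\<close> and \<open>b\<close> is an involution conjugating \<open>a\<close> to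
  its power \<open>2q - 1\<close>. The exponents range over all integers, so that the multiplication rule needs no
  reduction modulo \<open>4q\<close>; the reduction is confined to the equality of elements.\<close>

locale quasidihedral_coordinates = group G for G (structure) +
  fixes elt :: "int \<Rightarrow> bool \<Rightarrow> 'a" and q :: int
  assumes q_pos: "0 < q" and q_even: "even q"
    and elt_mult: "elt i e \<otimes> elt j f = elt (i + (if e then (2 * q - 1) * j else j)) (e \<noteq> f)"
    and elt_eq_iff: "elt i e = elt j f \<longleftrightarrow> 4 * q dvd i - j \<and> e = f"
    and carrier_eq: "carrier G = {elt i e | i e. True}"
begin

definition elt_block :: "int \<Rightarrow> bool \<Rightarrow> block" where
  "elt_block i e = (if e then Reflection (even i) else if 2 * q dvd i then Centre else Rotation)"

definition block_of :: "'a \<Rightarrow> block" where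
  "block_of g = (THE c. \<exists>i e. g = elt i e \<and> c = elt_block i e)"

lemma elt_closed [simp]: "elt i e \<in> carrier G"
  using carrier_eq by blast

lemma block_of_elt: "block_of (elt i e) = elt_block i e"
proof -
  have well_defined: "elt_block j f = elt_block i e" if "elt i e = elt j f" for j f
  proof -
    have "4 * q dvd i - j" and f: "e = f" using that by (auto simp: elt_eq_iff)
    then obtain r where "i = j + 4 * q * r" by (metis add.commute diff_add_cancel dvdE)
    then have "2 * q dvd i \<longleftrightarrow> 2 * q dvd j" and "even i \<longleftrightarrow> even j"
      by (auto simp: dvd_add_left_iff)
    then show ?thesis using f by (simp add: elt_block_def)
  qed
  show ?thesis
    unfolding block_of_def by (intro the_equality) (blast, metis well_defined)
qed

text \<open>Moving \<open>b\<close> past \<open>a\<^sup>x\<close> changes the exponent by \<open>(2q - 2)x = 2(q - 1)x\<close>. Since \<open>q\<close> is even, \<open>q - 1\<close> is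
  odd and hence prime to \<open>2q\<close>. For odd \<open>q\<close> this fails and the centre would be larger.\<close>

lemma dvd_cancel_twist: "4 * q dvd (2 * q - 2) * x \<longleftrightarrow> 2 * q dvd x"
proof -
  have "4 * q dvd (2 * q - 2) * x \<longleftrightarrow> 2 * (2 * q) dvd 2 * ((q - 1) * x)"
    by (simp add: algebra_simps)
  also have "\<dots> \<longleftrightarrow> 2 * q dvd (q - 1) * x" by (rule dvd_mult_cancel_left[THEN HOL.trans]) simp
  also have "coprime q (q - 1)"
    by (rule coprimeI) (metis diff_diff_eq2 add_diff_cancel_left' dvd_diff)
  then have "coprime (2 * q) (q - 1)"
    using q_even by simp
  then have "2 * q dvd (q - 1) * x \<longleftrightarrow> 2 * q dvd x"
    by (rule coprime_dvd_mult_right_iff)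
  finally show ?thesis .
qed

text \<open>A conjugate of the rotation \<open>a\<^sup>i\<close> is \<open>a\<^sup>i\<close> itself or its power with exponent \<open>(2q - 1)i\<close>, which is
  \<open>-i\<close> modulo \<open>2q\<close>; this preserves divisibility by \<open>2q\<close>. The exponent of a reflection keeps its
  parity because \<open>2q - 1\<close> is odd.\<close>

lemma conjugate_same_block:
  assumes "elt j f \<otimes> elt l t = elt l t \<otimes> elt i e"
  shows "elt_block j f = elt_block i e"
proof -
  from assms have f: "f = e"
    and d: "4 * q dvd (j + (if f then (2*q-1) * l else l)) - (l + (if t then (2*q-1) * i else i))"
    by (auto simp: elt_mult elt_eq_iff)
  show ?thesis
  proof (cases e)
    case True
    from d have "even (j + (if f then (2*q-1) * l else l) - (l + (if t then (2*q-1) * i else i)))"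
      by (rule dvd_trans[rotated]) simp
    then show ?thesis using True f by (auto simp: elt_block_def split: if_splits)
  next
    case False
    have "2 * q dvd 4 * q" by simp
    with d have *: "2 * q dvd (j + l) - (l + (if t then (2*q-1) * i else i))"
      using False f dvd_trans by auto
    have "2 * q dvd j \<longleftrightarrow> 2 * q dvd i"
    proof (cases t)
      case True
      with * have "2 * q dvd (j + i) - 2 * q * i" by (simp add: algebra_simps)
      then have "2 * q dvd j + i"
        by (metis dvd_triv_left dvd_diffD1 dvd_diff_commute dvd_add_right_iff diff_add_cancel)
      then show ?thesis by (metis dvd_add_right_iff dvd_add_left_iff)
    next
      case False
      with * have "2 * q dvd j - i" by simp
      then show ?thesis by (metis diff_add_cancel dvd_add_right_iff)
    qed
    then show ?thesis using False f by (simp add: elt_block_def)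
  qed
qed

text \<open>Only the pairs involving a reflection matter. A rotation commuting with a reflection is central,
  and two reflections commute only if their exponents differ by a multiple of \<open>2q\<close>.\<close>

lemma commuting_block_adj:
  assumes "elt i e \<otimes> elt j f = elt j f \<otimes> elt i e"
  shows "block_adj (elt_block i e) (elt_block j f)"
proof -
  have d: "4 * q dvd (i + (if e then (2*q-1) * j else j)) - (j + (if f then (2*q-1) * i else i))"
    using assms by (auto simp: elt_mult elt_eq_iff)
  consider "\<not> e" "\<not> f" | "e" "\<not> f" | "\<not> e" "f" | "e" "f" by blast
  then show ?thesis
  proof cases
    case 1
    then show ?thesis by (auto simp: elt_block_def block_adj_def)
  next
    case 2
    with d have "4 * q dvd (2 * q - 2) * j" by (simp add: algebra_simps)
    then show ?thesis using 2 by (simp add: elt_block_def block_adj_def dvd_cancel_twist)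
  next
    case 3
    with d have "4 * q dvd - ((2 * q - 2) * i)" by (simp add: algebra_simps)
    then show ?thesis using 3
      by (simp only: dvd_minus_iff dvd_cancel_twist) (simp add: elt_block_def block_adj_def)
  next
    case 4
    with d have "4 * q dvd (2 * q - 2) * (j - i)" by (simp add: algebra_simps)
    then have "2 * q dvd j - i" by (simp only: dvd_cancel_twist)
    then have "even (j - i)" by (rule dvd_trans[rotated]) simp
    then show ?thesis using 4 by (auto simp: elt_block_def block_adj_def)
  qed
qed

text \<open>Conjugating \<open>a\<^sup>i b\<close> by \<open>a\<^sup>x\<close> gives exponent \<open>i - (2q - 2)x\<close>, so \<open>(q - 1)x\<close> must be half of \<open>i - j\<close>
  modulo \<open>2q\<close>. As \<open>(q - 1)\<^sup>2\<close> is 1 modulo \<open>2q\<close> for even \<open>q\<close>, the factor \<open>q - 1\<close> is its own inverse.\<close>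

lemma same_parity_reflections_conjugate:
  assumes "even i \<longleftrightarrow> even j"
  shows "\<exists>x \<in> carrier G. elt j True \<otimes> x = x \<otimes> elt i True"
proof -
  have "even (i - j)" using assms by simp
  then obtain d where d: "i - j = 2 * d" by blast
  \<comment> \<open>\<open>p\<close> witnesses \<open>(q - 1)\<^sup>2 = 1 + 2q(p - 1)\<close>.\<close>
  obtain p where p: "q = 2 * p" using q_even by blast
  have "(j + (2*q-1) * ((q - 1) * d)) - ((q - 1) * d + i) = 4 * q * ((p - 1) * d)"
    using d p by (simp add: algebra_simps)
  then have "elt j True \<otimes> elt ((q - 1) * d) False = elt ((q - 1) * d) False \<otimes> elt i True"
    by (simp add: elt_mult elt_eq_iff)
  then show ?thesis by (meson elt_closed)
qed

lemma central_commutes: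
  assumes "elt_block i e = Centre"
  shows "elt i e \<otimes> elt j f = elt j f \<otimes> elt i e"
proof -
  have e: "\<not> e" and "2 * q dvd i" using assms by (auto simp: elt_block_def split: if_splits)
  then have "4 * q dvd (2 * q - 2) * i" by (simp add: dvd_cancel_twist)
  then have "4 * q dvd i + j - (j + (2 * q - 1) * i)"
    using dvd_minus_iff[of "4 * q" "(2 * q - 2) * i"] by (simp add: algebra_simps)
  then show ?thesis using e by (auto simp: elt_mult elt_eq_iff add.commute)
qed

text \<open>Blocks are unions of conjugacy classes, so passing to conjugates in the definition of the
  graph does not change the blocks; two elements of adjacent blocks are conjugate (reflections of
  one parity) or commute outright (all other cases).\<close>

lemma parcs_CSCom:
  "parcs (CSCom G) = {(g, h). g \<in> carrier G \<and> h \<in> carrier G \<and> g \<noteq> h \<and> block_adj (block_of g) (block_of h)}"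
proof -
  have conj: "block_of h = block_of g \<and> h \<in> carrier G"
    if hg: "h \<in> conj_class G g" and g: "g \<in> carrier G" for g h
  proof -
    from hg g obtain x where hx: "h \<in> carrier G" "x \<in> carrier G" "h \<otimes> x = x \<otimes> g"
      by (auto simp: conj_class_iff)
    then obtain i e j f l t where "g = elt i e" "h = elt j f" "x = elt l t"
      using g by (auto simp: carrier_eq)
    then show ?thesis
      using hx conjugate_same_block[of j f l t i e] by (simp add: block_of_elt)
  qed
  have self: "g \<in> conj_class G g" if "g \<in> carrier G" for g
    using that by (auto simp: conj_class_iff)
  have "(h \<in> conj_class G g \<or> (\<exists>g' \<in> conj_class G g. \<exists>h' \<in> conj_class G h. g' \<otimes> h' = h' \<otimes> g'))
    \<longleftrightarrow> block_adj (block_of g) (block_of h)" (is "?L \<longleftrightarrow> ?R")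
    if g: "g \<in> carrier G" and h: "h \<in> carrier G" for g h
  proof
    assume ?L
    then show ?R
    proof
      assume "h \<in> conj_class G g"
      then have "block_of h = block_of g" using conj g by blast
      then show ?R by (simp add: block_adj_def)
    next
      assume "\<exists>g' \<in> conj_class G g. \<exists>h' \<in> conj_class G h. g' \<otimes> h' = h' \<otimes> g'"
      then obtain g' h' where gh: "g' \<in> conj_class G g" "h' \<in> conj_class G h" "g' \<otimes> h' = h' \<otimes> g'"
        by blast
      then have "g' \<in> carrier G" "h' \<in> carrier G" using conj g h by blast+
      then obtain i e j f where "g' = elt i e" "h' = elt j f" by (auto simp: carrier_eq)
      then have "block_adj (block_of g') (block_of h')"
        using gh(3) commuting_block_adj[of i e j f] by (simp add: block_of_elt)
      moreover have "block_of g' = block_of g" "block_of h' = block_of h" using conj gh g h by blast+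
      ultimately show ?R by simp
    qed
  next
    assume R: ?R
    obtain i e where ie: "g = elt i e" using g by (auto simp: carrier_eq)
    obtain j f where jf: "h = elt j f" using h by (auto simp: carrier_eq)
    have "h \<in> conj_class G g \<or> g \<otimes> h = h \<otimes> g"
    proof (cases "e \<and> f")
      case True
      then have "even i \<longleftrightarrow> even j"
        using R by (auto simp: ie jf block_of_elt block_adj_def elt_block_def)
      then show ?thesis
        using True same_parity_reflections_conjugate by (auto simp: ie jf conj_class_iff)
    next
      case False
      then consider "\<not> e" "\<not> f" | "elt_block i e = Centre" | "elt_block j f = Centre"
        using R by (auto simp: ie jf block_of_elt block_adj_def elt_block_def split: if_splits)
      then show ?thesis
      proof cases
        case 1
        then show ?thesis by (simp add: ie jf elt_mult add.commute)
      next
        case 2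
        then show ?thesis using central_commutes[of i e j f] by (simp add: ie jf)
      next
        case 3
        then show ?thesis using central_commutes[of j f i e] by (simp add: ie jf)
      qed
    qed
    then show ?L using self g h by blast
  qed
  then show ?thesis unfolding CSCom_def by auto
qed

lemma inj_on_elt: "inj_on (\<lambda>(i, e). elt i e) ({0..<4 * q} \<times> UNIV)"
proof (rule inj_onI, clarsimp simp: elt_eq_iff)
  fix i j :: int
  assume "0 \<le> i" "i < 4 * q" "0 \<le> j" "j < 4 * q" "4 * q dvd i - j"
  then show "i = j" by (metis mod_eq_dvd_iff mod_pos_pos_trivial)
qed

lemma carrier_image: "carrier G = (\<lambda>(i, e). elt i e) ` ({0..<4 * q} \<times> UNIV)"
proof -
  have "elt i e \<in> (\<lambda>(i, e). elt i e) ` ({0..<4 * q} \<times> UNIV)" for i e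
  proof (rule image_eqI)
    have "4 * q dvd i - i mod (4 * q)" by (rule dvd_minus_mod)
    then show "elt i e = (\<lambda>(i, e). elt i e) (i mod (4 * q), e)"
      by (simp add: elt_eq_iff)
    show "(i mod (4 * q), e) \<in> {0..<4 * q} \<times> UNIV" using q_pos by simp
  qed
  then show ?thesis by (auto simp: carrier_eq)
qed

lemma finite_carrier: "finite (carrier G)"
  by (subst carrier_image) simp

lemma card_block_eq:
  "card {g \<in> carrier G. block_of g = c} = card {(i, e). 0 \<le> i \<and> i < 4 * q \<and> elt_block i e = c}"
proof -
  have "{g \<in> carrier G. block_of g = c} =
    (\<lambda>(i, e). elt i e) ` {(i, e). 0 \<le> i \<and> i < 4 * q \<and> elt_block i e = c}"
    by (subst carrier_image) (auto simp: block_of_elt)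
  moreover have "inj_on (\<lambda>(i, e). elt i e) {(i, e). 0 \<le> i \<and> i < 4 * q \<and> elt_block i e = c}"
    by (rule inj_on_subset[OF inj_on_elt]) auto
  ultimately show ?thesis by (simp add: card_image)
qed

lemma dvd_in_range_iff: "0 \<le> i \<Longrightarrow> i < 4 * q \<Longrightarrow> 2 * q dvd i \<longleftrightarrow> i \<in> {0, 2 * q}"
proof
  assume i: "0 \<le> i" "i < 4 * q" and "2 * q dvd i"
  then obtain r where r: "i = 2 * q * r" by blast
  have "0 \<le> r" using i q_pos r by (simp add: zero_le_mult_iff)
  moreover have "(2 * q) * r < (2 * q) * 2" using i r by linarith
  then have "r < 2" by (rule mult_less_cancel_left_pos[THEN iffD1, rotated]) (simp add: q_pos)
  ultimately have "r = 0 \<or> r = 1" by linarith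
  then show "i \<in> {0, 2 * q}" using r by auto
qed auto

lemma card_block:
  "card {g \<in> carrier G. block_of g = c} =
    (case c of Centre \<Rightarrow> 2 | Rotation \<Rightarrow> nat (4 * q) - 2 | Reflection _ \<Rightarrow> nat (2 * q))"
proof (cases c)
  case Centre
  have "{(i, e). 0 \<le> i \<and> i < 4 * q \<and> elt_block i e = c} = {0, 2 * q} \<times> {False}"
    using q_pos dvd_in_range_iff by (auto simp: Centre elt_block_def split: if_splits)
  then show ?thesis using q_pos by (simp add: card_block_eq Centre card_cartesian_product)
next
  case Rotation
  have "{(i, e). 0 \<le> i \<and> i < 4 * q \<and> elt_block i e = c} = ({0..<4 * q} - {0, 2 * q}) \<times> {False}"
    using q_pos dvd_in_range_iff by (auto simp: Rotation elt_block_def split: if_splits)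
  moreover have "card ({0..<4 * q} - {0, 2 * q}) = nat (4 * q) - 2"
    using q_pos by (subst card_Diff_subset) auto
  ultimately show ?thesis by (simp add: card_block_eq Rotation card_cartesian_product)
next
  case (Reflection p)
  let ?f = "\<lambda>j. (2 * j + (if p then 0 else 1), True)"
  have "{(i, e). 0 \<le> i \<and> i < 4 * q \<and> elt_block i e = c} = ?f ` {0..<2 * q}" (is "?A = ?B")
  proof
    show "?B \<subseteq> ?A" by (auto simp: Reflection elt_block_def)
    show "?A \<subseteq> ?B"
    proof
      fix x assume "x \<in> ?A"
      then obtain i e where x: "x = (i, e)" and i: "0 \<le> i" "i < 4 * q" "elt_block i e = c"
        by blast
      then have "e" "even i = p" by (auto simp: Reflection elt_block_def split: if_splits)
      then have "x = ?f (i div 2)" using x by auto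
      moreover have "i div 2 \<in> {0..<2 * q}" using i by auto
      ultimately show "x \<in> ?B" by (rule image_eqI)
    qed
  qed
  moreover have "inj_on ?f {0..<2 * q}" by (auto simp: inj_on_def)
  ultimately show ?thesis by (simp add: card_block_eq Reflection card_image)
qed

end

section \<open>Coordinates on the presented group\<close>

text \<open>The coordinates work for any presentation \<open>a\<^sup>n = 1\<close>, \<open>b\<^sup>2 = 1\<close>, \<open>b a b\<inverse> = a\<^sup>k\<close> in which
  \<open>k\<^sup>2\<close> is 1 modulo \<open>n\<close>: it presents the split extension of the cyclic group of order \<open>n\<close> by an
  involution acting as the power \<open>k\<close>. A letter acts on \<open>(i, e)\<close> as its left multiplication acts on
  \<open>a\<^sup>i b\<^sup>e\<close>.\<close>

fun letter_action :: "int \<Rightarrow> qd_gen letter \<Rightarrow> int \<times> bool \<Rightarrow> int \<times> bool" where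
  "letter_action k (Gen QD_a) (i, e) = (i + 1, e)"
| "letter_action k (Inv QD_a) (i, e) = (i - 1, e)"
| "letter_action k (Gen QD_b) (i, e) = (k * i, \<not> e)"
| "letter_action k (Inv QD_b) (i, e) = (k * i, \<not> e)"

definition same_coordinates :: "int \<Rightarrow> int \<times> bool \<Rightarrow> int \<times> bool \<Rightarrow> bool" where
  "same_coordinates n s t \<longleftrightarrow> n dvd fst s - fst t \<and> snd s = snd t"

definition split_relations :: "nat \<Rightarrow> nat \<Rightarrow> (qd_gen letter list \<times> qd_gen letter list) set" where
  "split_relations n k =
    { (replicate n (Gen QD_a), []),
      ([Gen QD_b, Gen QD_b], []),
      ([Gen QD_b, Gen QD_a, Inv QD_b], replicate k (Gen QD_a)) }"

lemma same_coordinates_trans: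
  "same_coordinates n r s \<Longrightarrow> same_coordinates n s t \<Longrightarrow> same_coordinates n r t"
  unfolding same_coordinates_def
  using dvd_add[of n "fst r - fst s" "fst s - fst t"] by simp

lemma same_coordinates_sym: "same_coordinates n s t \<Longrightarrow> same_coordinates n t s"
  unfolding same_coordinates_def by (simp add: dvd_diff_commute)

lemma letter_action_a_power:
  "(letter_action k (Gen QD_a) ^^ j) (i, e) = (i + int j, e)"
  by (induction j arbitrary: i) auto

lemma letter_action_cong:
  assumes "same_coordinates n s t"
  shows "same_coordinates n (letter_action k l s) (letter_action k l t)"
proof -
  obtain i e j f where st: "s = (i, e)" "t = (j, f)" by (metis prod.exhaust)
  have "n dvd i - j" "e = f" using assms by (auto simp: st same_coordinates_def)
  moreover from this have "n dvd k * i - k * j"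
    by (metis dvd_mult right_diff_distrib)
  ultimately show ?thesis
    by (cases "(k, l, s)" rule: letter_action.cases) (auto simp: st same_coordinates_def)
qed

lemma word_action_cong:
  "same_coordinates n s t \<Longrightarrow>
    same_coordinates n (foldr (letter_action k) w s) (foldr (letter_action k) w t)"
  by (induction w) (auto intro: letter_action_cong)

lemma dvd_twist_twice:
  fixes n k i :: int
  assumes "n dvd k * k - 1"
  shows "n dvd k * (k * i) - i"
proof -
  have "k * (k * i) - i = (k * k - 1) * i" by (simp add: algebra_simps)
  then show ?thesis using assms by simp
qed

text \<open>This is where a collapse of the presented group is excluded. The assumption that \<open>k\<^sup>2\<close> is 1
  modulo \<open>n\<close> makes \<open>b\<close> act as an involution; otherwise \<open>b\<^sup>2 = 1\<close> would force \<open>a\<close> to have order less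
  than \<open>n\<close>.\<close>

lemma pres_eq_same_action:
  fixes n k :: nat
  assumes k: "int n dvd int k * int k - 1"
    and "pres_eq (split_relations n k) u v" and "same_coordinates (int n) s t"
  shows "same_coordinates (int n) (foldr (letter_action (int k)) u s) (foldr (letter_action (int k)) v t)"
  using assms(2,3)
proof (induction arbitrary: s t rule: pres_eq.induct)
  case (rel u v)
  note kk = dvd_twist_twice[OF k]
  have "int n dvd int k * (int k * i + 1) - (i + int k)" for i
    using kk[of i] by (simp add: algebra_simps)
  with kk have "same_coordinates (int n) (foldr (letter_action (int k)) u s) (foldr (letter_action (int k)) v s)"
    using rel.hyps
    by (cases s) (auto simp: split_relations_def same_coordinates_def letter_action_a_power)
  then show ?case
    by (rule same_coordinates_trans[OF _ word_action_cong[OF rel.prems]])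
next
  case (cancel l)
  have "same_coordinates (int n) (foldr (letter_action (int k)) [l, flip_letter l] s) s"
    using dvd_twist_twice[OF k]
    by (cases "(int k, l, s)" rule: letter_action.cases) (auto simp: same_coordinates_def)
  then show ?case using same_coordinates_trans[OF _ cancel.prems] by simp
next
  case (refl u)
  then show ?case by (rule word_action_cong)
next
  case (sym u v)
  from sym.IH[OF same_coordinates_sym[OF sym.prems]] show ?case
    by (rule same_coordinates_sym)
next
  case (trans u v w)
  have "same_coordinates (int n) t t" by (simp add: same_coordinates_def)
  from trans.IH(1)[OF trans.prems] trans.IH(2)[OF this] show ?case
    by (rule same_coordinates_trans)
next
  case (append u u' v v')
  from append.IH(1)[OF append.IH(2)[OF append.prems]] show ?case
    by simp
qed

lemma surj_word_action:
  "\<exists>w. foldr (letter_action k) w (0, False) = (i, e)"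
proof -
  have ex: "\<exists>w. foldr (letter_action k) w (0, e) = (i, e)" for e
  proof (induction i rule: int_induct[of _ 0])
    case base
    show ?case by (intro exI[of _ "[]"]) simp
  next
    case (step1 i)
    then obtain w where "foldr (letter_action k) w (0, e) = (i, e)" by blast
    then show ?case by (intro exI[of _ "Gen QD_a # w"]) simp
  next
    case (step2 i)
    then obtain w where "foldr (letter_action k) w (0, e) = (i, e)" by blast
    then show ?case by (intro exI[of _ "Inv QD_a # w"]) simp
  qed
  show ?thesis
  proof (cases e)
    case True
    obtain w where "foldr (letter_action k) w (0, True) = (i, True)" using ex by blast
    then show ?thesis using True by (intro exI[of _ "w @ [Gen QD_b]"]) simp
  qed (use ex in auto)
qed

context
  fixes n k :: nat
begin

abbreviation "split_group \<equiv> presented_group (split_relations n k)"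

abbreviation word_class :: "qd_gen letter list \<Rightarrow> qd_gen letter list set" where
  "word_class w \<equiv> pres_rel (split_relations n k) `` {w}"

definition split_elt :: "int \<Rightarrow> bool \<Rightarrow> qd_gen letter list set" where
  "split_elt i e = word_class [Gen QD_a] [^]\<^bsub>split_group\<^esub> i \<otimes>\<^bsub>split_group\<^esub>
    (if e then word_class [Gen QD_b] else \<one>\<^bsub>split_group\<^esub>)"

interpretation group split_group by (rule group_presented_group)

lemma word_class_closed [simp]: "word_class w \<in> carrier split_group"
  by (auto simp: presented_group_def quotient_def)

lemma carrier_word_class: "carrier split_group = range word_class"
  by (auto simp: presented_group_def quotient_def)

lemma one_word_class: "\<one>\<^bsub>split_group\<^esub> = word_class []"
  by (simp add: presented_group_def)

lemma word_class_eq_iff: "word_class u = word_class v \<longleftrightarrow> pres_eq (split_relations n k) u v"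
  using eq_equiv_class_iff[OF equiv_pres_rel, of u v] by (simp add: pres_rel_def)

lemma word_class_Inv: "word_class [Inv x] = inv\<^bsub>split_group\<^esub> (word_class [Gen x])"
proof -
  have "pres_eq (split_relations n k) [Inv x, Gen x] []"
    using pres_eq.cancel[of _ "Inv x"] by simp
  then have "word_class [Inv x] \<otimes>\<^bsub>split_group\<^esub> word_class [Gen x] = \<one>\<^bsub>split_group\<^esub>"
    by (simp add: mult_presented_group one_word_class word_class_eq_iff)
  then show ?thesis using inv_equality by simp
qed

lemma word_class_replicate:
  "word_class (replicate j x) = word_class [x] [^]\<^bsub>split_group\<^esub> j"
proof (induction j)
  case (Suc j)
  have "word_class (replicate (Suc j) x) = word_class (replicate j x) \<otimes>\<^bsub>split_group\<^esub> word_class [x]"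
    by (simp add: mult_presented_group replicate_append_same)
  then show ?case using Suc by simp
qed (simp add: one_word_class)

lemma relations_hold:
  "word_class (replicate n (Gen QD_a)) = word_class []"
  "word_class [Gen QD_b, Gen QD_b] = word_class []"
  "word_class [Gen QD_b, Gen QD_a, Inv QD_b] = word_class (replicate k (Gen QD_a))"
  unfolding word_class_eq_iff by (rule pres_eq.rel; simp add: split_relations_def)+

lemma a_pow_order: "word_class [Gen QD_a] [^]\<^bsub>split_group\<^esub> n = \<one>\<^bsub>split_group\<^esub>"
  by (simp only: word_class_replicate[symmetric] one_word_class relations_hold)

lemma b_square: "word_class [Gen QD_b] \<otimes>\<^bsub>split_group\<^esub> word_class [Gen QD_b] = \<one>\<^bsub>split_group\<^esub>"
  by (simp add: mult_presented_group one_word_class relations_hold)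

lemma b_conj_a:
  "word_class [Gen QD_b] \<otimes>\<^bsub>split_group\<^esub> word_class [Gen QD_a] =
    word_class [Gen QD_a] [^]\<^bsub>split_group\<^esub> int k \<otimes>\<^bsub>split_group\<^esub> word_class [Gen QD_b]"
proof -
  have "word_class [Gen QD_b, Gen QD_a, Inv QD_b] =
    word_class [Gen QD_b] \<otimes>\<^bsub>split_group\<^esub> word_class [Gen QD_a] \<otimes>\<^bsub>split_group\<^esub> inv\<^bsub>split_group\<^esub> (word_class [Gen QD_b])"
    by (simp add: word_class_Inv[symmetric] mult_presented_group)
  then have "word_class [Gen QD_b] \<otimes>\<^bsub>split_group\<^esub> word_class [Gen QD_a] \<otimes>\<^bsub>split_group\<^esub>
      inv\<^bsub>split_group\<^esub> (word_class [Gen QD_b]) = word_class [Gen QD_a] [^]\<^bsub>split_group\<^esub> int k"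
    by (simp add: relations_hold word_class_replicate int_pow_int)
  then show ?thesis
    by (metis inv_solve_right' m_closed word_class_closed int_pow_closed)
qed

text \<open>The exponent is an integer, so the induction runs in both directions from 0; the downward step
  cancels one factor \<open>a\<close> on the right.\<close>

lemma b_conj_pow:
  "word_class [Gen QD_b] \<otimes>\<^bsub>split_group\<^esub> word_class [Gen QD_a] [^]\<^bsub>split_group\<^esub> (i::int) =
    word_class [Gen QD_a] [^]\<^bsub>split_group\<^esub> (int k * i) \<otimes>\<^bsub>split_group\<^esub> word_class [Gen QD_b]"
  (is "?b \<otimes>\<^bsub>split_group\<^esub> ?a [^]\<^bsub>split_group\<^esub> i = _")
proof (induction i rule: int_induct[of _ 0])
  case base
  show ?case by simp
next
  case (step1 i)
  have "?b \<otimes>\<^bsub>split_group\<^esub> ?a [^]\<^bsub>split_group\<^esub> (i + 1) =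
    ?b \<otimes>\<^bsub>split_group\<^esub> ?a [^]\<^bsub>split_group\<^esub> i \<otimes>\<^bsub>split_group\<^esub> ?a"
    by (simp add: int_pow_mult m_assoc)
  also have "\<dots> = ?a [^]\<^bsub>split_group\<^esub> (int k * i) \<otimes>\<^bsub>split_group\<^esub> (?b \<otimes>\<^bsub>split_group\<^esub> ?a)"
    using step1 by (simp add: m_assoc)
  also have "\<dots> = ?a [^]\<^bsub>split_group\<^esub> (int k * (i + 1)) \<otimes>\<^bsub>split_group\<^esub> ?b"
    by (simp add: b_conj_a int_pow_mult m_assoc[symmetric] distrib_left)
  finally show ?case .
next
  case (step2 i)
  have "?b \<otimes>\<^bsub>split_group\<^esub> ?a [^]\<^bsub>split_group\<^esub> (i - 1) \<otimes>\<^bsub>split_group\<^esub> ?a =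
    ?b \<otimes>\<^bsub>split_group\<^esub> (?a [^]\<^bsub>split_group\<^esub> (i - 1) \<otimes>\<^bsub>split_group\<^esub> ?a [^]\<^bsub>split_group\<^esub> (1::int))"
    by (simp add: m_assoc)
  also have "\<dots> = ?b \<otimes>\<^bsub>split_group\<^esub> ?a [^]\<^bsub>split_group\<^esub> i"
    by (subst int_pow_mult[symmetric]) simp_all
  also have "\<dots> = ?a [^]\<^bsub>split_group\<^esub> (int k * (i - 1) + int k) \<otimes>\<^bsub>split_group\<^esub> ?b"
    using step2 by (simp add: algebra_simps)
  also have "\<dots> = ?a [^]\<^bsub>split_group\<^esub> (int k * (i - 1)) \<otimes>\<^bsub>split_group\<^esub> (?b \<otimes>\<^bsub>split_group\<^esub> ?a)"
    by (simp add: b_conj_a int_pow_mult m_assoc)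
  finally show ?case
    by (simp add: m_assoc[symmetric] del: mult_presented_group)
qed

lemma split_elt_mult:
  "split_elt i e \<otimes>\<^bsub>split_group\<^esub> split_elt j f = split_elt (i + (if e then int k * j else j)) (e \<noteq> f)"
  (is "?L = ?R")
proof -
  let ?a = "word_class [Gen QD_a]" and ?b = "word_class [Gen QD_b]"
  let ?B = "\<lambda>e. if e then ?b else \<one>\<^bsub>split_group\<^esub>"
  have B: "?B e \<in> carrier split_group" for e by simp
  have move: "?B e \<otimes>\<^bsub>split_group\<^esub> ?a [^]\<^bsub>split_group\<^esub> j =
    ?a [^]\<^bsub>split_group\<^esub> (if e then int k * j else j) \<otimes>\<^bsub>split_group\<^esub> ?B e"
    by (simp add: b_conj_pow)
  have BB: "?B e \<otimes>\<^bsub>split_group\<^esub> ?B f = ?B (e \<noteq> f)"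
    by (simp add: b_square)
  have "?L = ?a [^]\<^bsub>split_group\<^esub> i \<otimes>\<^bsub>split_group\<^esub>
      (?B e \<otimes>\<^bsub>split_group\<^esub> ?a [^]\<^bsub>split_group\<^esub> j) \<otimes>\<^bsub>split_group\<^esub> ?B f"
    unfolding split_elt_def by (simp only: m_assoc B word_class_closed int_pow_closed m_closed)
  also have "\<dots> = ?a [^]\<^bsub>split_group\<^esub> i \<otimes>\<^bsub>split_group\<^esub> ?a [^]\<^bsub>split_group\<^esub> (if e then int k * j else j)
      \<otimes>\<^bsub>split_group\<^esub> (?B e \<otimes>\<^bsub>split_group\<^esub> ?B f)"
    unfolding move by (simp only: m_assoc B word_class_closed int_pow_closed m_closed)
  also have "\<dots> = ?R"
    unfolding BB split_elt_def by (simp only: int_pow_mult word_class_closed)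
  finally show ?thesis .
qed

text \<open>The action of a word on \<open>(0, False)\<close> reads off its coordinates. This gives surjectivity of
  \<open>split_elt\<close> and, together with the invariance of the action, its injectivity modulo \<open>n\<close>.\<close>

lemma word_class_split_elt:
  "word_class w = (case foldr (letter_action (int k)) w (0, False) of (i, e) \<Rightarrow> split_elt i e)"
proof (induction w)
  case Nil
  show ?case by (simp add: split_elt_def one_word_class[symmetric])
next
  case (Cons l w)
  obtain i e where ie: "foldr (letter_action (int k)) w (0, False) = (i, e)" by force
  have "word_class (l # w) = word_class [l] \<otimes>\<^bsub>split_group\<^esub> split_elt i e"
    using Cons ie mult_presented_group[of "split_relations n k" "[l]" w] by simp
  moreover have "word_class [Gen QD_a] = split_elt 1 False"
    "word_class [Gen QD_b] = split_elt 0 True"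
    "word_class [Inv QD_a] = split_elt (-1) False"
    "word_class [Inv QD_b] = split_elt 0 True"
    using inv_equality[OF b_square] by (simp_all add: split_elt_def word_class_Inv int_pow_neg)
  ultimately show ?case
    using ie by (cases "(int k, l, i, e)" rule: letter_action.cases) (simp_all add: split_elt_mult add.commute)
qed

lemma carrier_split_group: "carrier split_group = {split_elt i e | i e. True}"
proof -
  have "\<exists>w. split_elt i e = word_class w" for i e
    using surj_word_action[of "int k" i e] word_class_split_elt by (metis case_prod_conv)
  moreover have "\<exists>i e. word_class w = split_elt i e" for w
    using word_class_split_elt by (metis case_prod_unfold)
  ultimately show ?thesis unfolding carrier_word_class by (auto, blast+)
qed

lemma split_elt_eq_iff:
  assumes k: "int n dvd int k * int k - 1"
  shows "split_elt i e = split_elt j f \<longleftrightarrow> int n dvd i - j \<and> e = f"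
proof
  assume eq: "split_elt i e = split_elt j f"
  obtain u v where u: "foldr (letter_action (int k)) u (0, False) = (i, e)"
    and v: "foldr (letter_action (int k)) v (0, False) = (j, f)"
    using surj_word_action by metis
  then have "word_class u = word_class v"
    using eq by (simp add: word_class_split_elt)
  then have "pres_eq (split_relations n k) u v" by (simp only: word_class_eq_iff)
  then have "same_coordinates (int n) (i, e) (j, f)"
    using pres_eq_same_action[OF k, of u v "(0, False)" "(0, False)"] u v
    by (simp add: same_coordinates_def)
  then show "int n dvd i - j \<and> e = f" by (simp add: same_coordinates_def)
next
  assume "int n dvd i - j \<and> e = f"
  then obtain r where "i = int n * r + j" and e: "e = f" by (metis diff_add_cancel dvdE)
  moreover have "word_class [Gen QD_a] [^]\<^bsub>split_group\<^esub> (int n * r) = \<one>\<^bsub>split_group\<^esub>"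
    by (simp add: int_pow_pow[symmetric] int_pow_int a_pow_order)
  ultimately show "split_elt i e = split_elt j f"
    by (simp add: split_elt_def int_pow_mult)
qed

end

text \<open>With \<open>q = 2\<^sup>m\<^sup>-\<^sup>3\<close> the square of the twist is \<open>(2q - 1)\<^sup>2 = 1 + 4q(q - 1)\<close>, so the action is well
  defined, and \<open>m \<ge> 4\<close> is what makes \<open>q\<close> even.\<close>

lemma quasidihedral_group_coordinates:
  assumes "m \<ge> 4"
  shows "quasidihedral_coordinates (quasidihedral_group m)
    (split_elt (2 ^ (m - 1)) (2 ^ (m - 2) - 1)) (2 ^ (m - 3))"
proof -
  let ?q = "2 ^ (m - 3) :: int"
  have m: "m - 1 = Suc (Suc (m - 3))" "m - 2 = Suc (m - 3)" using assms by auto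
  have n: "int (2 ^ (m - 1)) = 4 * ?q" unfolding m by simp
  have k: "int (2 ^ (m - 2) - 1) = 2 * ?q - 1" unfolding m by (simp add: of_nat_diff)
  have QD: "quasidihedral_group m = presented_group (split_relations (2 ^ (m - 1)) (2 ^ (m - 2) - 1))"
    by (simp add: quasidihedral_group_def split_relations_def)
  have "(2 * ?q - 1) * (2 * ?q - 1) - 1 = 4 * ?q * (?q - 1)" by (simp add: algebra_simps)
  then have sq: "int (2 ^ (m - 1)) dvd int (2 ^ (m - 2) - 1) * int (2 ^ (m - 2) - 1) - 1"
    unfolding n k by simp
  interpret group "quasidihedral_group m"
    unfolding QD by (rule group_presented_group)
  show ?thesis
  proof
    show "0 < ?q" by simp
    show "even ?q" using assms by simp
  next
    fix i j e f
    show "split_elt (2 ^ (m - 1)) (2 ^ (m - 2) - 1) i e \<otimes>\<^bsub>quasidihedral_group m\<^esub>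
        split_elt (2 ^ (m - 1)) (2 ^ (m - 2) - 1) j f =
      split_elt (2 ^ (m - 1)) (2 ^ (m - 2) - 1) (i + (if e then (2 * ?q - 1) * j else j)) (e \<noteq> f)"
      unfolding QD split_elt_mult k ..
    show "split_elt (2 ^ (m - 1)) (2 ^ (m - 2) - 1) i e = split_elt (2 ^ (m - 1)) (2 ^ (m - 2) - 1) j f
      \<longleftrightarrow> 4 * ?q dvd i - j \<and> e = f"
      unfolding split_elt_eq_iff[OF sq] n ..
  next
    show "carrier (quasidihedral_group m) =
      {split_elt (2 ^ (m - 1)) (2 ^ (m - 2) - 1) i e | i e. True}"
      unfolding QD by (rule carrier_split_group)
  qed
qed

section \<open>The target graph and the isomorphism\<close>

abbreviation (input) three_cliques_cone ::
    "nat \<Rightarrow> nat \<Rightarrow> (nat + ((nat \<times> nat) + nat)) pair_pre_digraph" where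
  "three_cliques_cone r s \<equiv> join_graph (complete_pair_graph 2)
    (disjoint_union_graph (copies_graph 2 (complete_pair_graph r)) (complete_pair_graph s))"

text \<open>The two copies of the complete graph on \<open>r\<close> vertices take the place of the two parities of reflections.\<close>

fun join_block :: "nat + ((nat \<times> nat) + nat) \<Rightarrow> block" where
  "join_block (Inl x) = Centre"
| "join_block (Inr (Inl (i, x))) = Reflection (i = 0)"
| "join_block (Inr (Inr x)) = Rotation"

lemma pverts_three_cliques_cone:
  "pverts (three_cliques_cone r s) = {..<2} <+> ({..<2} \<times> {..<r}) <+> {..<s}"
  by (simp add: join_graph_def disjoint_union_graph_def copies_graph_def complete_pair_graph_def)

lemma parcs_three_cliques_cone:
  "parcs (three_cliques_cone r s) = {(u, v). u \<in> pverts (three_cliques_cone r s) \<and>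
    v \<in> pverts (three_cliques_cone r s) \<and> u \<noteq> v \<and> block_adj (join_block u) (join_block v)}"
  by (auto simp: join_graph_def disjoint_union_graph_def copies_graph_def
      complete_pair_graph_def block_adj_def less_2_cases_iff)

lemma card_join_block:
  "card {v \<in> pverts (three_cliques_cone r s). join_block v = c} =
    (case c of Centre \<Rightarrow> 2 | Rotation \<Rightarrow> s | Reflection _ \<Rightarrow> r)"
proof (cases c)
  case Centre
  have "{v \<in> pverts (three_cliques_cone r s). join_block v = c} = Inl ` {..<2}"
    by (auto simp: pverts_three_cliques_cone Centre)
  then show ?thesis by (simp add: Centre card_image)
next
  case Rotation
  have "{v \<in> pverts (three_cliques_cone r s). join_block v = c} = (\<lambda>x. Inr (Inr x)) ` {..<s}"
    by (auto simp: pverts_three_cliques_cone Rotation)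
  then show ?thesis by (simp add: Rotation card_image inj_on_def)
next
  case (Reflection p)
  have "{v \<in> pverts (three_cliques_cone r s). join_block v = c} =
    (\<lambda>x. Inr (Inl (if p then 0 else 1, x))) ` {..<r}"
    by (auto simp: pverts_three_cliques_cone Reflection less_2_cases_iff split: if_splits)
  then show ?thesis by (simp add: Reflection card_image inj_on_def)
qed

theorem corollary2p7:
  fixes m :: nat
  assumes "m \<ge> 4"
  shows "digraph_iso
    (with_proj (CSCom (quasidihedral_group m)))
    (with_proj (join_graph (complete_pair_graph 2)
      (disjoint_union_graph
        (copies_graph 2 (complete_pair_graph (2 ^ (m - 2))))
        (complete_pair_graph (2 ^ (m - 1) - 2)))))"
proof -
  interpret quasidihedral_coordinates "quasidihedral_group m"
    "split_elt (2 ^ (m - 1)) (2 ^ (m - 2) - 1)" "2 ^ (m - 3)"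
    by (rule quasidihedral_group_coordinates[OF assms])
  have m: "m - 1 = Suc (Suc (m - 3))" "m - 2 = Suc (m - 3)" using assms by auto
  have sizes: "nat (4 * 2 ^ (m - 3)) = 2 ^ (m - 1)" "nat (2 * 2 ^ (m - 3)) = 2 ^ (m - 2)"
    unfolding m by (simp_all add: nat_mult_distrib nat_power_eq)
  have verts: "pverts (CSCom (quasidihedral_group m)) = carrier (quasidihedral_group m)"
    by (simp add: CSCom_def)
  show ?thesis
  proof (rule digraph_iso_by_colours[where c = block_of and d = join_block and adj = block_adj])
    show "finite (pverts (CSCom (quasidihedral_group m)))"
      unfolding verts by (rule finite_carrier)
    show "finite (pverts (three_cliques_cone (2 ^ (m - 2)) (2 ^ (m - 1) - 2)))"
      unfolding pverts_three_cliques_cone by simp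
    show "card {u \<in> pverts (CSCom (quasidihedral_group m)). block_of u = c} =
      card {v \<in> pverts (three_cliques_cone (2 ^ (m - 2)) (2 ^ (m - 1) - 2)). join_block v = c}" for c
      unfolding verts card_block card_join_block sizes ..
  qed (unfold verts, rule parcs_CSCom, rule parcs_three_cliques_cone)
qed

end
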